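(* Let $\mathcal{P}$ be an $L$-convex polyomino. Then there exists a Ferrer diagram $\mathcal{P}^*$ such that the bipartite graphs $F_{\mathcal{P}}$ and $F_{\mathcal{P}^*}$ are isomorphic.
   Context: A cell is a set $C=[a,a+(1,1)]$ with $a\in\mathbb{N}^2$ its lower left corner, where $[(i,j),(k,\ell)]=\{(r,s)\in\mathbb{N}^2: i\le r\le k,\ j\le s\le \ell\}$; its vertices are $a,a+(1,0),a+(0,1),a+(1,1)$ and its edges are the four sides of the unit square. A finite collection $\mathcal{P}$ of cells is a polyomino if any two of its cells can be joined by a sequence of cells of $\mathcal{P}$ in which consecutive cells share an edge; such a sequence with distinct cells is a path. $\mathcal{P}$ is convex if whenever two cells of $\mathcal{P}$ lie in the same row (resp. column) all cells between them in that row (resp. column) belong to $\mathcal{P}$. A path $C_1,\dots,C_q$, with $(i_k,j_k)$ the lower left corner of $C_k$, has a change of direction at $C_k$ ($2\le k\le q-1$) if $i_{k-1}\ne i_{k+1}$ and $j_{k-1}\ne j_{k+1}$. A convex polyomino is $L$-convex if any two of its cells can be connected by a path of its cells with at most one change of direction. After translation the bounding box of $\mathcal{P}$ (smallest rectangle containing it) is $[(0,0),(m,n)]$; rows of cells are numbered $1,\dots,n$ from top to bottom, columns $1,\dots,m$ from left to right, and $C_{ij}$ is the cell in row $i$ and column $j$. $F_{\mathcal{P}}$ is the bipartite graph on $\{X_1,\dots,X_m\}\sqcup\{Y_1,\dots,Y_n\}$ with $\{X_j,Y_i\}$ an edge iff $C_{ij}$ is a cell of $\mathcal{P}$. A Ferrer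 graph is a bipartite graph $G$ on $\{u_1,\dots,u_m\}\sqcup\{v_1,\dots,v_n\}$ such that $\{u_1,v_n\},\{u_m,v_1\}\in E(G)$ and, if $\{u_i,v_j\}\in E(G)$, then $\{u_r,v_s\}\in E(G)$ for all $1\le r\le i$ and $1\le s\le j$. A Ferrer diagram is a polyomino $\mathcal{P}$ such that $F_{\mathcal{P}}$ (with $u_j=X_j$ and $v_i=Y_i$ in the given labelling) is a Ferrer graph. *)

theory Defs
  imports "HOL-Library.Product_Plus" "HOL-Library.Product_Order"
begin

text \<open>Pairs carry the componentwise order, so \<open>{a..b}\<close> is the lattice rectangle with
  lower left corner \<open>a\<close> and upper right corner \<open>b\<close>.\<close>

type_synonym point = "nat \<times> nat"

definition cell :: "point \<Rightarrow> point set" where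
  "cell a = {a..a + (1, 1)}"

definition corner :: "point set \<Rightarrow> point" where
  "corner C = (THE a. C = cell a)"

lemma inj_cell: "inj cell"
  by (rule injI) (simp add: cell_def Icc_eq_Icc less_eq_prod_def)

lemma corner_cell [simp]: "corner (cell a) = a"
  unfolding corner_def by (rule the_equality) (auto dest: injD[OF inj_cell])

definition edges_of :: "point set \<Rightarrow> point set set" where
  "edges_of C = (let a = corner C in
     {{a, a + (1, 0)}, {a, a + (0, 1)}, {a + (1, 0), a + (1, 1)}, {a + (0, 1), a + (1, 1)}})"

definition share_edge :: "point set \<Rightarrow> point set \<Rightarrow> bool" where
  "share_edge C D \<longleftrightarrow> edges_of C \<inter> edges_of D \<noteq> {}"

definition joins :: "point set set \<Rightarrow> point set \<Rightarrow> point set \<Rightarrow> point set list \<Rightarrow> bool" where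
  "joins P C D cs \<longleftrightarrow>
     cs \<noteq> [] \<and> hd cs = C \<and> last cs = D \<and> set cs \<subseteq> P \<and> successively share_edge cs"

text \<open>Polyominoes are nonempty: the bounding box of the empty collection does not exist.\<close>

definition polyomino :: "point set set \<Rightarrow> bool" where
  "polyomino P \<longleftrightarrow> finite P \<and> P \<noteq> {} \<and> P \<subseteq> range cell \<and>
     (\<forall>C\<in>P. \<forall>D\<in>P. \<exists>cs. joins P C D cs)"

definition convex_polyomino :: "point set set \<Rightarrow> bool" where
  "convex_polyomino P \<longleftrightarrow> polyomino P \<and>
     (\<forall>i k j. cell (i, j) \<in> P \<longrightarrow> cell (k, j) \<in> P \<longrightarrow> (\<forall>r\<in>{i..k}. cell (r, j) \<in> P)) \<and>
     (\<forall>i j l. cell (i, j) \<in> P \<longrightarrow> cell (i, l) \<in> P \<longrightarrow> (\<forall>s\<in>{j..l}. cell (i, s) \<in> P))"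

text \<open>Positions in the list are counted from \<open>0\<close>, so the interior positions of a path
  of length \<open>q\<close> are \<open>1, \<dots>, q - 2\<close>.\<close>

definition direction_changes :: "point set list \<Rightarrow> nat set" where
  "direction_changes cs = {k. 1 \<le> k \<and> k + 1 < length cs \<and>
     fst (corner (cs ! (k - 1))) \<noteq> fst (corner (cs ! (k + 1))) \<and>
     snd (corner (cs ! (k - 1))) \<noteq> snd (corner (cs ! (k + 1)))}"

definition L_convex_polyomino :: "point set set \<Rightarrow> bool" where
  "L_convex_polyomino P \<longleftrightarrow> convex_polyomino P \<and>
     (\<forall>C\<in>P. \<forall>D\<in>P. \<exists>cs. joins P C D cs \<and> distinct cs \<and> card (direction_changes cs) \<le> 1)"

definition box_lower :: "point set set \<Rightarrow> point" where
  "box_lower P = (Min (fst ` \<Union>P), Min (snd ` \<Union>P))"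

definition box_upper :: "point set set \<Rightarrow> point" where
  "box_upper P = (Max (fst ` \<Union>P), Max (snd ` \<Union>P))"

lemma finite_cell [simp]: "finite (cell a)"
proof -
  have "cell a \<subseteq> {fst a..fst a + 1} \<times> {snd a..snd a + 1}"
    by (auto simp: cell_def less_eq_prod_def)
  then show ?thesis by (rule finite_subset) simp
qed

lemma bounding_box_least:
  assumes "polyomino P"
  shows "\<Union>P \<subseteq> {a..b} \<longleftrightarrow> {box_lower P..box_upper P} \<subseteq> {a..b}"
proof -
  have fin: "finite (\<Union>P)"
  proof (rule finite_Union)
    show "finite P" using assms by (simp add: polyomino_def)
    have "P \<subseteq> range cell" using assms by (simp add: polyomino_def)
    then show "finite C" if "C \<in> P" for C
      using that by auto
  qed
  have "P \<noteq> {}" "P \<subseteq> range cell"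
    using assms by (simp_all add: polyomino_def)
  then obtain c where "cell c \<in> P"
    by blast
  then have c: "c \<in> \<Union>P"
    by (rule UnionI) (simp add: cell_def less_eq_prod_def)
  define V where "V = \<Union>P"
  have finV: "finite (fst ` V)" "finite (snd ` V)"
    using fin unfolding V_def by (rule finite_imageI)+
  have neV: "fst ` V \<noteq> {}" "snd ` V \<noteq> {}"
    using c unfolding V_def by blast+
  have box: "box_lower P = (Min (fst ` V), Min (snd ` V))"
    "box_upper P = (Max (fst ` V), Max (snd ` V))"
    by (simp_all only: box_lower_def box_upper_def V_def)
  have in_box: "V \<subseteq> {box_lower P..box_upper P}"
  proof
    fix x assume "x \<in> V"
    then have "fst x \<in> fst ` V" "snd x \<in> snd ` V" by (rule imageI)+
    with finV show "x \<in> {box_lower P..box_upper P}"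
      by (simp add: box less_eq_prod_def)
  qed
  obtain p where p: "p \<in> V" "Min (fst ` V) = fst p"
    using Min_in[OF finV(1) neV(1)] by (rule imageE)
  obtain q where q: "q \<in> V" "Min (snd ` V) = snd q"
    using Min_in[OF finV(2) neV(2)] by (rule imageE)
  obtain r where r: "r \<in> V" "Max (fst ` V) = fst r"
    using Max_in[OF finV(1) neV(1)] by (rule imageE)
  obtain s where s: "s \<in> V" "Max (snd ` V) = snd s"
    using Max_in[OF finV(2) neV(2)] by (rule imageE)
  have "{box_lower P..box_upper P} \<subseteq> {a..b}" if "V \<subseteq> {a..b}"
  proof -
    have "a \<le> box_lower P" "box_upper P \<le> b"
      using subsetD[OF that p(1)] subsetD[OF that q(1)] subsetD[OF that r(1)]
        subsetD[OF that s(1)]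
      by (simp_all add: box p q r s less_eq_prod_def)
    then show ?thesis
      by (simp add: atLeastatMost_subset_iff)
  qed
  then show ?thesis
    using in_box unfolding V_def by (blast intro: subset_trans)
qed

definition width :: "point set set \<Rightarrow> nat" where
  "width P = fst (box_upper P) - fst (box_lower P)"

definition height :: "point set set \<Rightarrow> nat" where
  "height P = snd (box_upper P) - snd (box_lower P)"

text \<open>The cell in row \<open>i\<close> (counted from the top) and column \<open>j\<close> (counted from the left) of
  the bounding box, for \<open>1 \<le> i \<le> height P\<close> and \<open>1 \<le> j \<le> width P\<close>. Instead of first
  translating the box to the origin, indices are taken relative to its corners.\<close>

definition box_cell :: "point set set \<Rightarrow> nat \<Rightarrow> nat \<Rightarrow> point set" where
  "box_cell P i j = cell (fst (box_lower P) + (j - 1), snd (box_upper P) - i)"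

text \<open>A simple graph is a pair of a vertex set and a set of two-element edges.\<close>

type_synonym 'v graph = "'v set \<times> 'v set set"

definition bipartite_on :: "'v graph \<Rightarrow> 'v set \<Rightarrow> 'v set \<Rightarrow> bool" where
  "bipartite_on G A B \<longleftrightarrow>
     fst G = A \<union> B \<and> A \<inter> B = {} \<and> (\<forall>e\<in>snd G. \<exists>a\<in>A. \<exists>b\<in>B. e = {a, b})"

definition graph_isomorphic :: "'v graph \<Rightarrow> 'w graph \<Rightarrow> bool" where
  "graph_isomorphic G H \<longleftrightarrow> (\<exists>f. bij_betw f (fst G) (fst H) \<and>
     (\<forall>x\<in>fst G. \<forall>y\<in>fst G. {x, y} \<in> snd G \<longleftrightarrow> {f x, f y} \<in> snd H))"

definition ferrer_graph :: "nat \<Rightarrow> nat \<Rightarrow> (nat \<Rightarrow> 'v) \<Rightarrow> (nat \<Rightarrow> 'v) \<Rightarrow> 'v graph \<Rightarrow> bool" where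
  "ferrer_graph m n u v G \<longleftrightarrow>
     inj_on u {1..m} \<and> inj_on v {1..n} \<and> bipartite_on G (u ` {1..m}) (v ` {1..n}) \<and>
     {u 1, v n} \<in> snd G \<and> {u m, v 1} \<in> snd G \<and>
     (\<forall>i\<in>{1..m}. \<forall>j\<in>{1..n}. {u i, v j} \<in> snd G \<longrightarrow>
        (\<forall>r\<in>{1..i}. \<forall>s\<in>{1..j}. {u r, v s} \<in> snd G))"

datatype vertex = X nat | Y nat

definition F :: "point set set \<Rightarrow> vertex graph" where
  "F P = (X ` {1..width P} \<union> Y ` {1..height P},
     {{X j, Y i} | i j. i \<in> {1..height P} \<and> j \<in> {1..width P} \<and> box_cell P i j \<in> P})"

definition ferrer_diagram :: "point set set \<Rightarrow> bool" where
  "ferrer_diagram P \<longleftrightarrow> polyomino P \<and> ferrer_graph (width P) (height P) X Y (F P)"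

end

theory Submission imports Defs begin

text \<open>A path with at most one change of direction stays in one line up to its turn and in
  another line after it, so for any two cells of an \<open>L\<close>-convex polyomino one of the two
  remaining corners of the rectangle they span is also a cell. Hence the sets of rows met by the
  columns form a chain under inclusion, and dually. Sorting rows and columns by decreasing number
  of cells turns \<open>F P\<close> into a Ferrer graph. Applied to cells in the two extreme columns, the corner
  property and convexity give a row that meets every column of the bounding box, so no vertex of
  \<open>F P\<close> is isolated, and the sorted diagram has a box of the same size.\<close>

section \<open>Paths of cells\<close>

lemma share_edge_refl: "share_edge C C"
  by (simp add: share_edge_def edges_of_def Let_def)

lemma share_edge_sym: "share_edge C D \<Longrightarrow> share_edge D C"
  by (auto simp: share_edge_def)

text \<open>Aligned corners are all that the analysis of paths needs from adjacency: the argument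
  about straight segments never uses that the corners are at distance one.\<close>

lemma share_edge_cell_aligned:
  assumes "share_edge (cell a) (cell b)"
  shows "fst a = fst b \<or> snd a = snd b"
  using assms
  by (cases a; cases b) (auto simp: share_edge_def edges_of_def Let_def doubleton_eq_iff)

lemma share_edge_right: "share_edge (cell (x, y)) (cell (Suc x, y))"
  by (auto simp: share_edge_def edges_of_def Let_def)

lemma share_edge_above: "share_edge (cell (x, y)) (cell (x, Suc y))"
  by (auto simp: share_edge_def edges_of_def Let_def)

lemma joins_refl: "C \<in> P \<Longrightarrow> joins P C C [C]"
  by (simp add: joins_def)

lemma joins_share_edge:
  "C \<in> P \<Longrightarrow> D \<in> P \<Longrightarrow> share_edge C D \<Longrightarrow> joins P C D [C, D]"
  by (simp add: joins_def)

text \<open>\<open>D\<close> occurs twice in a row in the concatenation; this is harmless because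
  \<open>share_edge\<close> is reflexive and \<open>joins\<close> allows repeated cells.\<close>

lemma joins_append: "joins P C D cs \<Longrightarrow> joins P D E ds \<Longrightarrow> joins P C E (cs @ ds)"
  by (simp add: joins_def successively_append_iff share_edge_refl)

lemma joins_rev:
  assumes "joins P C D cs"
  shows "joins P D C (rev cs)"
proof -
  have "successively (\<lambda>x y. share_edge y x) cs"
    using assms by (auto simp: joins_def elim!: successively_mono intro: share_edge_sym)
  then show ?thesis
    using assms by (simp add: joins_def hd_rev last_rev)
qed

text \<open>Induction on the right end. Suppose the first coordinate has been constant so far but
  changes in the step to \<open>Suc e\<close>. Then that step keeps the second coordinate, and the
  absence of a turn at \<open>e\<close> gives \<open>p d\<close> the same second coordinate, so
  \<open>p d = p e\<close>, which is excluded. The other direction is symmetric.\<close>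

lemma straight_segment:
  fixes p :: "nat \<Rightarrow> 'a \<times> 'b"
  assumes "s \<le> e"
    and "\<And>k. s \<le> k \<Longrightarrow> k < e \<Longrightarrow> p k \<noteq> p (Suc k)"
    and "\<And>k. s \<le> k \<Longrightarrow> k < e \<Longrightarrow> fst (p k) = fst (p (Suc k)) \<or> snd (p k) = snd (p (Suc k))"
    and "\<And>k. s \<le> k \<Longrightarrow> Suc k < e \<Longrightarrow>
           fst (p k) = fst (p (Suc (Suc k))) \<or> snd (p k) = snd (p (Suc (Suc k)))"
  shows "(\<forall>k\<in>{s..e}. fst (p k) = fst (p s)) \<or> (\<forall>k\<in>{s..e}. snd (p k) = snd (p s))"
  using assms
proof (induction e rule: dec_induct)
  case base
  then show ?case by simp
next
  case (step e)
  have split: "(\<forall>k\<in>{s..Suc e}. Q k) \<longleftrightarrow> (\<forall>k\<in>{s..e}. Q k) \<and> Q (Suc e)" for Q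
    using step.hyps by (auto simp: le_Suc_eq)
  have IH: "(\<forall>k\<in>{s..e}. fst (p k) = fst (p s)) \<or> (\<forall>k\<in>{s..e}. snd (p k) = snd (p s))"
    by (rule step.IH) (use step.prems in \<open>auto simp: less_Suc_eq\<close>)
  have last: "fst (p e) = fst (p (Suc e)) \<or> snd (p e) = snd (p (Suc e))"
    using step by simp
  show ?case
  proof (cases "e = s")
    case True
    then show ?thesis using last unfolding split by auto
  next
    case False
    then obtain d where d: "e = Suc d" "s \<le> d"
      using step.hyps by (cases e) auto
    have turn: "fst (p d) = fst (p (Suc e)) \<or> snd (p d) = snd (p (Suc e))"
      using step.prems(3)[of d] d by simp
    have ne: "p d \<noteq> p e"
      using step.prems(1)[of d] d by simp
    have "d \<in> {s..e}" "e \<in> {s..e}"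
      using d by auto
    with IH show ?thesis
      unfolding split by (metis last turn ne prod_eq_iff)
  qed
qed

text \<open>The position of the turn cuts the path into two straight segments, so the cell there is
  aligned with both end cells.\<close>

lemma L_path_corner:
  assumes P: "P \<subseteq> range cell"
    and cs: "joins P (cell (a, b)) (cell (c, d)) cs" "distinct cs"
    and turns: "card (direction_changes cs) \<le> 1"
  shows "cell (a, d) \<in> P \<or> cell (c, b) \<in> P"
proof -
  define p where "p k = corner (cs ! k)" for k
  define q where "q = length cs - 1"
  have q: "length cs = Suc q"
    using cs(1) by (cases cs) (auto simp: q_def joins_def)
  have in_P: "cs ! k \<in> P" and cell_p: "cell (p k) = cs ! k" if "k \<le> q" for k
  proof -
    show "cs ! k \<in> P"
      using cs(1) that q by (auto simp: joins_def)
    then obtain z where "cs ! k = cell z"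
      using P by auto
    then show "cell (p k) = cs ! k"
      by (simp add: p_def)
  qed
  have "cs ! 0 = cell (a, b)" "cs ! q = cell (c, d)"
    using cs(1) hd_conv_nth[of cs] last_conv_nth[of cs] by (auto simp: joins_def q)
  then have ends: "p 0 = (a, b)" "p q = (c, d)"
    by (simp_all add: p_def)
  have ne: "p k \<noteq> p (Suc k)" if "k < q" for k
  proof -
    have "cs ! k \<noteq> cs ! Suc k"
      using cs(2) that q by (simp add: nth_eq_iff_index_eq)
    then show ?thesis
      using cell_p[of k] cell_p[of "Suc k"] that by auto
  qed
  have step: "fst (p k) = fst (p (Suc k)) \<or> snd (p k) = snd (p (Suc k))" if "k < q" for k
  proof (rule share_edge_cell_aligned)
    show "share_edge (cell (p k)) (cell (p (Suc k)))"
      using cs(1) that q by (simp add: cell_p joins_def successively_conv_nth)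
  qed
  have "finite (direction_changes cs)"
    by (rule finite_subset[of _ "{..length cs}"]) (auto simp: direction_changes_def)
  \<comment> \<open>\<open>t\<close> is the position of the only change of direction; if there is
    none, any position on the path will do.\<close>
  then obtain t where t: "t \<le> q" "direction_changes cs \<subseteq> {t}"
  proof (cases "direction_changes cs = {}")
    case False
    then have "card (direction_changes cs) = 1"
      using turns \<open>finite (direction_changes cs)\<close> by (metis card_0_eq le_eq_less_or_eq less_one)
    then obtain t where t: "direction_changes cs = {t}"
      by (rule card_1_singletonE)
    then have "t \<in> direction_changes cs"
      by simp
    then have "t \<le> q"
      by (simp add: direction_changes_def q)
    with t show ?thesis using that by simp
  qed (use that in auto)
  have straight: "fst (p k) = fst (p (Suc (Suc k))) \<or> snd (p k) = snd (p (Suc (Suc k)))"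
    if "Suc k < q" "Suc k \<noteq> t" for k
  proof -
    have "Suc k \<notin> direction_changes cs"
      using t(2) that(2) by auto
    then show ?thesis
      using that(1) by (auto simp: direction_changes_def q p_def)
  qed
  have "(\<forall>k\<in>{0..t}. fst (p k) = fst (p 0)) \<or> (\<forall>k\<in>{0..t}. snd (p k) = snd (p 0))"
  proof (rule straight_segment)
    fix k
    show "p k \<noteq> p (Suc k)" if "k < t"
      using that t(1) by (intro ne) simp
    show "fst (p k) = fst (p (Suc k)) \<or> snd (p k) = snd (p (Suc k))" if "k < t"
      using that t(1) by (intro step) simp
    show "fst (p k) = fst (p (Suc (Suc k))) \<or> snd (p k) = snd (p (Suc (Suc k)))" if "Suc k < t"
      by (rule straight) (use that t(1) in simp_all)
  qed simp
  moreover have "t \<in> {0..t}"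
    by simp
  ultimately have "fst (p t) = fst (p 0) \<or> snd (p t) = snd (p 0)"
    by blast
  then have seg1: "fst (p t) = a \<or> snd (p t) = b"
    by (simp add: ends)
  have "(\<forall>k\<in>{t..q}. fst (p k) = fst (p t)) \<or> (\<forall>k\<in>{t..q}. snd (p k) = snd (p t))"
  proof (rule straight_segment[OF t(1)])
    fix k
    show "p k \<noteq> p (Suc k)" if "k < q"
      using that by (rule ne)
    show "fst (p k) = fst (p (Suc k)) \<or> snd (p k) = snd (p (Suc k))" if "k < q"
      using that by (rule step)
    show "fst (p k) = fst (p (Suc (Suc k))) \<or> snd (p k) = snd (p (Suc (Suc k)))"
      if "t \<le> k" "Suc k < q"
      by (rule straight) (use that in simp_all)
  qed
  moreover have "q \<in> {t..q}"
    using t(1) by simp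
  ultimately have "fst (p q) = fst (p t) \<or> snd (p q) = snd (p t)"
    by blast
  then have seg2: "fst (p t) = c \<or> snd (p t) = d"
    by (auto simp: ends)
  have p_in_P: "cell (p k) \<in> P" if "k \<le> q" for k
    using in_P[OF that] by (simp only: cell_p[OF that])
  obtain u v where uv: "p t = (u, v)"
    by (rule prod.exhaust)
  have "u = a \<or> v = b" "u = c \<or> v = d"
    using seg1 seg2 by (simp_all add: uv)
  moreover have "cell (a, b) \<in> P" "cell (c, d) \<in> P" "cell (u, v) \<in> P"
    using p_in_P[of 0] p_in_P[of q] p_in_P[OF t(1)] by (simp_all add: ends uv)
  \<comment> \<open>If the two alignments use different coordinates, the cell at \<open>t\<close> is
    itself a missing corner. If they use the same one, then \<open>a = c\<close> or
    \<open>b = d\<close>, and the corners coincide with the given cells.\<close>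
  ultimately show ?thesis
    by metis
qed

lemma L_convex_corner:
  assumes "L_convex_polyomino P" "cell (a, b) \<in> P" "cell (c, d) \<in> P"
  shows "cell (a, d) \<in> P \<or> cell (c, b) \<in> P"
proof -
  have "P \<subseteq> range cell"
    using assms(1) by (simp add: L_convex_polyomino_def convex_polyomino_def polyomino_def)
  moreover obtain cs where "joins P (cell (a, b)) (cell (c, d)) cs" "distinct cs"
    "card (direction_changes cs) \<le> 1"
    using assms unfolding L_convex_polyomino_def by blast
  ultimately show ?thesis
    by (rule L_path_corner)
qed

section \<open>Bounding boxes\<close>

lemma Min_Un_Suc_image:
  assumes "finite A" "A \<noteq> {}"
  shows "Min (A \<union> Suc ` A) = Min A"
  using assms by (intro Min_eqI) (auto intro: le_SucI)

lemma Max_Un_Suc_image: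
  assumes "finite A" "A \<noteq> {}"
  shows "Max (A \<union> Suc ` A) = Suc (Max A)"
  using assms by (intro Max_eqI) (auto intro: le_SucI)

lemma cell_eq: "cell a = {fst a, Suc (fst a)} \<times> {snd a, Suc (snd a)}"
  by (cases a) (auto simp: cell_def less_eq_prod_def)

lemma fst_Union_cells: "fst ` \<Union>(cell ` S) = fst ` S \<union> Suc ` fst ` S"
  by (force simp: cell_eq)

lemma snd_Union_cells: "snd ` \<Union>(cell ` S) = snd ` S \<union> Suc ` snd ` S"
  by (force simp: cell_eq)

text \<open>\<open>S\<close> records lower left corners while the box bounds vertices. Each cell
  adds the successor of its corner coordinates, which moves the maxima by one and leaves the minima
  alone.\<close>

lemma box_cells:
  assumes "finite S" "S \<noteq> {}"
  shows "box_lower (cell ` S) = (Min (fst ` S), Min (snd ` S))"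
    and "box_upper (cell ` S) = (Suc (Max (fst ` S)), Suc (Max (snd ` S)))"
  using assms
  by (simp_all add: box_lower_def box_upper_def fst_Union_cells snd_Union_cells
      Min_Un_Suc_image Max_Un_Suc_image)

lemma L_convex_box:
  assumes "L_convex_polyomino P"
  shows L_convex_column: "\<forall>j\<in>{1..width P}. \<exists>i\<in>{1..height P}. box_cell P i j \<in> P"
    and L_convex_row: "\<forall>i\<in>{1..height P}. \<exists>j\<in>{1..width P}. box_cell P i j \<in> P"
    and L_convex_width_pos: "1 \<le> width P"
    and L_convex_height_pos: "1 \<le> height P"
proof -
  have poly: "finite P" "P \<noteq> {}" "P \<subseteq> range cell"
    using assms by (simp_all add: L_convex_polyomino_def convex_polyomino_def polyomino_def)
  have row_conv: "cell (r, j) \<in> P"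
    if "cell (i, j) \<in> P" "cell (k, j) \<in> P" "i \<le> r" "r \<le> k" for i j k r
    using assms that unfolding L_convex_polyomino_def convex_polyomino_def
    by (meson atLeastAtMost_iff)
  have col_conv: "cell (i, s) \<in> P"
    if "cell (i, j) \<in> P" "cell (i, l) \<in> P" "j \<le> s" "s \<le> l" for i j l s
    using assms that unfolding L_convex_polyomino_def convex_polyomino_def
    by (meson atLeastAtMost_iff)
  define S where "S = {a. cell a \<in> P}"
  have P_eq: "P = cell ` S"
    using poly(3) by (auto simp: S_def)
  have S: "finite S" "S \<noteq> {}"
    using poly(1,2) finite_imageD[of cell S] inj_cell by (auto simp: P_eq intro: inj_on_subset)
  define x0 x1 y0 y1 where bounds: "x0 = Min (fst ` S)" "x1 = Max (fst ` S)"
    "y0 = Min (snd ` S)" "y1 = Max (snd ` S)"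
  have range: "x0 \<le> x" "x \<le> x1" "y0 \<le> y" "y \<le> y1" if "cell (x, y) \<in> P" for x y
  proof -
    have "(x, y) \<in> S" using that by (simp add: S_def)
    then have "x \<in> fst ` S" "y \<in> snd ` S" by force+
    then show "x0 \<le> x" "x \<le> x1" "y0 \<le> y" "y \<le> y1" using S(1) by (simp_all add: bounds)
  qed
  have box: "fst (box_lower P) = x0" "snd (box_upper P) = Suc y1"
    "width P = Suc x1 - x0" "height P = Suc y1 - y0"
    using box_cells[OF S] by (simp_all add: P_eq bounds width_def height_def)
  have "x0 \<in> fst ` S" "x1 \<in> fst ` S" "y0 \<in> snd ` S" "y1 \<in> snd ` S"
    using S by (simp_all add: bounds)
  then obtain a b c d where left: "cell (x0, b) \<in> P" and right: "cell (x1, d) \<in> P"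
    and bottom: "cell (a, y0) \<in> P" and top: "cell (c, y1) \<in> P"
    by (auto simp: S_def)
  \<comment> \<open>Opposite extreme columns contain cells at heights \<open>b\<close> and
    \<open>d\<close>; the corner property puts one of these heights in both columns, and that height
    is \<open>y\<close>.\<close>
  obtain y where full_row: "cell (x0, y) \<in> P" "cell (x1, y) \<in> P"
    using L_convex_corner[OF assms left right] left right by blast
  obtain x where full_column: "cell (x, y0) \<in> P" "cell (x, y1) \<in> P"
    using L_convex_corner[OF assms bottom top] bottom top by blast
  note x = range[OF full_column(1)] and y = range[OF full_row(1)]
  show "1 \<le> width P" "1 \<le> height P"
    using x y box by simp_all
  show "\<forall>j\<in>{1..width P}. \<exists>i\<in>{1..height P}. box_cell P i j \<in> P"
  proof
    fix j assume j: "j \<in> {1..width P}"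
    have "cell (x0 + (j - 1), y) \<in> P"
      by (rule row_conv[OF full_row]) (use j box in auto)
    \<comment> \<open>Rows are counted from the top edge at height \<open>Suc y1\<close>, so the
      cell with corner height \<open>y\<close> has row index \<open>Suc y1 - y\<close>;
      \<open>y \<le> y1\<close> makes the truncated subtraction invertible.\<close>
    then have "box_cell P (Suc y1 - y) j \<in> P"
      using y by (simp add: box_cell_def box)
    moreover have "Suc y1 - y \<in> {1..height P}"
      using y box by auto
    ultimately show "\<exists>i\<in>{1..height P}. box_cell P i j \<in> P" by blast
  qed
  show "\<forall>i\<in>{1..height P}. \<exists>j\<in>{1..width P}. box_cell P i j \<in> P"
  proof
    fix i assume i: "i \<in> {1..height P}"
    have "cell (x, Suc y1 - i) \<in> P"
      by (rule col_conv[OF full_column]) (use i box in auto)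
    then have "box_cell P i (Suc (x - x0)) \<in> P"
      using x by (simp add: box_cell_def box)
    moreover have "Suc (x - x0) \<in> {1..width P}"
      using x box by auto
    ultimately show "\<exists>j\<in>{1..width P}. box_cell P i j \<in> P" by blast
  qed
qed

section \<open>Sorting a chain graph\<close>

lemma ex_bij_betw_antimono:
  fixes f :: "nat \<Rightarrow> nat"
  obtains \<sigma> where "bij_betw \<sigma> {1..m} {1..m}"
    and "\<And>r i. 1 \<le> r \<Longrightarrow> r \<le> i \<Longrightarrow> i \<le> m \<Longrightarrow> f (\<sigma> i) \<le> f (\<sigma> r)"
proof -
  \<comment> \<open>\<open>sort_key\<close> sorts upwards, so the key is negated, in
    \<open>int\<close> because negation fails on \<open>nat\<close>. List positions start at
    \<open>0\<close> and indices at \<open>1\<close>, hence the shift in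
    \<open>\<sigma>\<close>.\<close>
  define xs where "xs = sort_key (\<lambda>x. - int (f x)) [1..<Suc m]"
  define \<sigma> where "\<sigma> = (\<lambda>i. xs ! (i - 1))"
  have xs: "distinct xs" "set xs = {1..m}" "length xs = m"
    by (auto simp: xs_def)
  have "bij_betw (\<lambda>i. i - 1) {1..m} {..<m}"
    by (rule bij_betw_byWitness[where f' = Suc]) auto
  moreover have "bij_betw ((!) xs) {..<m} {1..m}"
    using xs by (intro bij_betw_nth) auto
  ultimately have "bij_betw ((!) xs \<circ> (\<lambda>i. i - 1)) {1..m} {1..m}"
    by (rule bij_betw_trans)
  then have "bij_betw \<sigma> {1..m} {1..m}"
    by (simp add: \<sigma>_def comp_def)
  moreover have "f (\<sigma> i) \<le> f (\<sigma> r)" if "1 \<le> r" "r \<le> i" "i \<le> m" for r i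
  proof -
    have "sorted (map (\<lambda>x. - int (f x)) xs)"
      by (simp add: xs_def)
    then have "map (\<lambda>x. - int (f x)) xs ! (r - 1) \<le> map (\<lambda>x. - int (f x)) xs ! (i - 1)"
      by (rule sorted_nth_mono) (use that xs in auto)
    then show ?thesis
      using that xs by (simp add: \<sigma>_def)
  qed
  ultimately show thesis by (rule that)
qed

text \<open>Among pairwise comparable finite sets, cardinality decides inclusion, so it suffices to
  sort by decreasing cardinality. If the inclusion is the wrong way round, the cardinalities force
  equality.\<close>

lemma ex_bij_betw_chain_antimono:
  fixes N :: "nat \<Rightarrow> 'a set"
  assumes fin: "\<And>j. finite (N j)"
    and chain: "\<And>i j. i \<in> {1..m} \<Longrightarrow> j \<in> {1..m} \<Longrightarrow> N i \<subseteq> N j \<or> N j \<subseteq> N i"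
  obtains \<sigma> where "bij_betw \<sigma> {1..m} {1..m}"
    and "\<And>r i. 1 \<le> r \<Longrightarrow> r \<le> i \<Longrightarrow> i \<le> m \<Longrightarrow> N (\<sigma> i) \<subseteq> N (\<sigma> r)"
proof -
  obtain \<sigma> where \<sigma>: "bij_betw \<sigma> {1..m} {1..m}"
    and le: "\<And>r i. 1 \<le> r \<Longrightarrow> r \<le> i \<Longrightarrow> i \<le> m \<Longrightarrow> card (N (\<sigma> i)) \<le> card (N (\<sigma> r))"
    using ex_bij_betw_antimono[of m "\<lambda>j. card (N j)"] by blast
  have "N (\<sigma> i) \<subseteq> N (\<sigma> r)" if "1 \<le> r" "r \<le> i" "i \<le> m" for r i
  proof -
    have "\<sigma> i \<in> {1..m}" "\<sigma> r \<in> {1..m}"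
      by (rule bij_betw_apply[OF \<sigma>], use that in simp)+
    then show ?thesis
      using chain[of "\<sigma> i" "\<sigma> r"] card_seteq[OF fin _ le[OF that]] by blast
  qed
  with \<sigma> show thesis by (rule that)
qed

text \<open>The hypothesis says that the bipartite graph of \<open>R\<close> has no two edges
  inducing a perfect matching. Incomparable neighbourhoods of \<open>j\<close> and \<open>l\<close>
  would supply such a pair: some \<open>i\<close> adjacent only to \<open>j\<close> and some
  \<open>k\<close> adjacent only to \<open>l\<close>.\<close>

lemma chain_graph_sorting:
  fixes R :: "nat \<Rightarrow> nat \<Rightarrow> bool"
  assumes R: "\<And>j i l k. j \<in> {1..m} \<Longrightarrow> l \<in> {1..m} \<Longrightarrow> i \<in> {1..n} \<Longrightarrow> k \<in> {1..n} \<Longrightarrow>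
    R j i \<Longrightarrow> R l k \<Longrightarrow> R j k \<or> R l i"
  obtains \<sigma> \<tau> where "bij_betw \<sigma> {1..m} {1..m}" "bij_betw \<tau> {1..n} {1..n}"
    and "\<And>r j s i. 1 \<le> r \<Longrightarrow> r \<le> j \<Longrightarrow> j \<le> m \<Longrightarrow> 1 \<le> s \<Longrightarrow> s \<le> i \<Longrightarrow> i \<le> n \<Longrightarrow>
      R (\<sigma> j) (\<tau> i) \<Longrightarrow> R (\<sigma> r) (\<tau> s)"
proof -
  obtain \<sigma> where \<sigma>: "bij_betw \<sigma> {1..m} {1..m}"
    and \<sigma>_mono: "\<And>r j. 1 \<le> r \<Longrightarrow> r \<le> j \<Longrightarrow> j \<le> m \<Longrightarrow>
      {i\<in>{1..n}. R (\<sigma> j) i} \<subseteq> {i\<in>{1..n}. R (\<sigma> r) i}"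
  proof (rule ex_bij_betw_chain_antimono[of "\<lambda>j. {i\<in>{1..n}. R j i}" m])
    show "{i\<in>{1..n}. R j i} \<subseteq> {i\<in>{1..n}. R l i} \<or> {i\<in>{1..n}. R l i} \<subseteq> {i\<in>{1..n}. R j i}"
      if "j \<in> {1..m}" "l \<in> {1..m}" for j l
      using R that by blast
  qed auto
  obtain \<tau> where \<tau>: "bij_betw \<tau> {1..n} {1..n}"
    and \<tau>_mono: "\<And>s i. 1 \<le> s \<Longrightarrow> s \<le> i \<Longrightarrow> i \<le> n \<Longrightarrow>
      {j\<in>{1..m}. R j (\<tau> i)} \<subseteq> {j\<in>{1..m}. R j (\<tau> s)}"
  proof (rule ex_bij_betw_chain_antimono[of "\<lambda>i. {j\<in>{1..m}. R j i}" n])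
    show "{j\<in>{1..m}. R j i} \<subseteq> {j\<in>{1..m}. R j k} \<or> {j\<in>{1..m}. R j k} \<subseteq> {j\<in>{1..m}. R j i}"
      if "i \<in> {1..n}" "k \<in> {1..n}" for i k
      using R that by blast
  qed auto
  have "R (\<sigma> r) (\<tau> s)"
    if "1 \<le> r" "r \<le> j" "j \<le> m" "1 \<le> s" "s \<le> i" "i \<le> n" "R (\<sigma> j) (\<tau> i)" for r j s i
  proof -
    \<comment> \<open>The two sorts do not interfere: first pass from column
      \<open>\<sigma> j\<close> to \<open>\<sigma> r\<close> within row \<open>\<tau> i\<close>,
      then from row \<open>\<tau> i\<close> to \<open>\<tau> s\<close> within column
      \<open>\<sigma> r\<close>.\<close>
    have "\<sigma> r \<in> {1..m}" "\<tau> i \<in> {1..n}"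
      by (rule bij_betw_apply[OF \<sigma>] bij_betw_apply[OF \<tau>], use that in simp)+
    then show ?thesis
      using \<sigma>_mono[OF that(1-3)] \<tau>_mono[OF that(4-6)] that(7) by blast
  qed
  with \<sigma> \<tau> show thesis by (rule that)
qed

section \<open>The Ferrer diagram of a staircase relation\<close>

lemma F_edge_iff:
  "{x, y} \<in> snd (F P) \<longleftrightarrow> (\<exists>i\<in>{1..height P}. \<exists>j\<in>{1..width P}.
     box_cell P i j \<in> P \<and> (x = X j \<and> y = Y i \<or> x = Y i \<and> y = X j))"
  by (auto simp: F_def doubleton_eq_iff)

text \<open>The cells are placed where \<open>R\<close> holds. \<open>R1n\<close> and
  \<open>Rm1\<close> make the first column and the first row full, which fixes the size of the box;
  \<open>down\<close> makes every cell reachable from the top left one.\<close>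

lemma ferrer_diagram_of_relation:
  fixes R :: "nat \<Rightarrow> nat \<Rightarrow> bool"
  assumes m: "1 \<le> m" and n: "1 \<le> n"
    and down: "\<And>r j s i. 1 \<le> r \<Longrightarrow> r \<le> j \<Longrightarrow> j \<le> m \<Longrightarrow> 1 \<le> s \<Longrightarrow> s \<le> i \<Longrightarrow> i \<le> n \<Longrightarrow>
      R j i \<Longrightarrow> R r s"
    and R1n: "R 1 n" and Rm1: "R m 1"
  obtains Q where "ferrer_diagram Q" "width Q = m" "height Q = n"
    and "\<And>i j. i \<in> {1..n} \<Longrightarrow> j \<in> {1..m} \<Longrightarrow> box_cell Q i j \<in> Q \<longleftrightarrow> R j i"
proof -
  \<comment> \<open>Row \<open>i\<close> is counted from the top of a box of height
    \<open>n\<close>, so its cells have lower left corners at height \<open>n - i\<close>; column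
    \<open>1\<close> starts at \<open>0\<close>.\<close>
  define S where "S = {(j - 1, n - i) | i j. i \<in> {1..n} \<and> j \<in> {1..m} \<and> R j i}"
  define Q where "Q = cell ` S"
  have S_iff: "(j - 1, n - i) \<in> S \<longleftrightarrow> R j i" if "i \<in> {1..n}" "j \<in> {1..m}" for i j
  proof
    assume "(j - 1, n - i) \<in> S"
    then obtain i' j' where "j - 1 = j' - 1" "n - i = n - i'" "i' \<in> {1..n}" "j' \<in> {1..m}" "R j' i'"
      by (auto simp: S_def)
    moreover from this that have "j' = j" "i' = i" by auto
    ultimately show "R j i" by simp
  qed (use that in \<open>auto simp: S_def\<close>)
  have "S \<subseteq> {..m} \<times> {..n}"
    by (auto simp: S_def)
  then have fin: "finite S"
    by (rule finite_subset) simp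
  \<comment> \<open>These are the bottom cell of the first column and the last cell of the top row;
    together they touch all four sides of the box.\<close>
  have corners: "(0, 0) \<in> S" "(m - 1, n - 1) \<in> S"
    using S_iff[of n 1] S_iff[of 1 m] R1n Rm1 m n by auto
  have "fst a \<le> m - 1" "snd a \<le> n - 1" if "a \<in> S" for a
    using that by (auto simp: S_def)
  then have extremes: "Min (fst ` S) = 0" "Min (snd ` S) = 0"
    "Max (fst ` S) = m - 1" "Max (snd ` S) = n - 1"
    using fin corners by (force intro!: Min_eqI Max_eqI)+
  have "S \<noteq> {}" using corners by blast
  then have lower: "box_lower Q = (0, 0)" and upper: "box_upper Q = (m, n)"
    using box_cells[OF fin] m n by (simp_all add: Q_def extremes)
  have wh: "width Q = m" "height Q = n"
    by (simp_all add: width_def height_def lower upper)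
  have box_Q: "box_cell Q i j = cell (j - 1, n - i)" for i j
    by (simp add: box_cell_def lower upper)
  have Q_iff: "box_cell Q i j \<in> Q \<longleftrightarrow> R j i" if "i \<in> {1..n}" "j \<in> {1..m}" for i j
    unfolding box_Q by (simp only: Q_def inj_image_mem_iff[OF inj_cell] S_iff[OF that])
  \<comment> \<open>Every cell is joined to the top left cell by going left along its row to column
    \<open>1\<close> and then up; \<open>down\<close> keeps all cells on the way in
    \<open>Q\<close>.\<close>
  have to_top: "\<exists>cs. joins Q (box_cell Q i 1) (box_cell Q 1 1) cs"
    if "1 \<le> i" "i \<le> n" "R 1 i" for i
    using that
  proof (induction i rule: dec_induct)
    case base
    then show ?case using Q_iff[of 1 1] m n joins_refl by fastforce
  next
    case (step i)
    then have R: "R 1 i" using down[of 1 1 i "Suc i"] m by simp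
    then obtain cs where "joins Q (box_cell Q i 1) (box_cell Q 1 1) cs"
      using step by auto
    moreover have "n - i = Suc (n - Suc i)"
      using step.prems by simp
    then have "share_edge (box_cell Q (Suc i) 1) (box_cell Q i 1)"
      by (simp add: box_Q share_edge_above)
    then have "joins Q (box_cell Q (Suc i) 1) (box_cell Q i 1)
        [box_cell Q (Suc i) 1, box_cell Q i 1]"
      using Q_iff[of "Suc i" 1] Q_iff[of i 1] step R m by (intro joins_share_edge) auto
    ultimately show ?case
      using joins_append by blast
  qed
  have to_corner: "\<exists>cs. joins Q (box_cell Q i j) (box_cell Q 1 1) cs"
    if "1 \<le> j" "j \<le> m" "1 \<le> i" "i \<le> n" "R j i" for i j
    using that
  proof (induction j rule: dec_induct)
    case base
    then show ?case using to_top by simp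
  next
    case (step j)
    then have R: "R j i" using down[of j "Suc j" i i] by simp
    then obtain cs where "joins Q (box_cell Q i j) (box_cell Q 1 1) cs"
      using step by auto
    moreover have "share_edge (box_cell Q i (Suc j)) (box_cell Q i j)"
      using step.hyps share_edge_right[of "j - 1" "n - i"]
      by (simp add: box_Q share_edge_sym)
    then have "joins Q (box_cell Q i (Suc j)) (box_cell Q i j)
        [box_cell Q i (Suc j), box_cell Q i j]"
      using Q_iff[of i "Suc j"] Q_iff[of i j] step R by (intro joins_share_edge) auto
    ultimately show ?case
      using joins_append by blast
  qed
  have connected: "\<exists>cs. joins Q C (box_cell Q 1 1) cs" if "C \<in> Q" for C
  proof -
    have "C \<in> cell ` S"
      using that by (simp add: Q_def)
    then obtain i j where "C = box_cell Q i j" "i \<in> {1..n}" "j \<in> {1..m}" "R j i"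
      by (auto simp: S_def box_Q)
    then show ?thesis using to_corner by auto
  qed
  have edge: "{X j, Y i} \<in> snd (F Q) \<longleftrightarrow> R j i" if "i \<in> {1..n}" "j \<in> {1..m}" for i j
    using that Q_iff[OF that] by (auto simp: F_edge_iff wh)
  have "polyomino Q"
    unfolding polyomino_def
  proof (intro conjI ballI)
    show "finite Q" "Q \<noteq> {}" "Q \<subseteq> range cell"
      using fin \<open>S \<noteq> {}\<close> by (auto simp: Q_def)
    show "\<exists>cs. joins Q C D cs" if "C \<in> Q" "D \<in> Q" for C D
      using connected[OF that(1)] connected[OF that(2)] joins_rev joins_append by meson
  qed
  moreover have "ferrer_graph m n X Y (F Q)"
    unfolding ferrer_graph_def
  proof (intro conjI ballI impI)
    have "\<exists>a\<in>X ` {1..m}. \<exists>b\<in>Y ` {1..n}. e = {a, b}" if "e \<in> snd (F Q)" for e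
      using that unfolding F_def wh snd_conv by blast
    then show "bipartite_on (F Q) (X ` {1..m}) (Y ` {1..n})"
      by (auto simp: bipartite_on_def F_def wh)
    show "{X 1, Y n} \<in> snd (F Q)" "{X m, Y 1} \<in> snd (F Q)"
      using edge[of n 1] edge[of 1 m] m n R1n Rm1 by auto
    show "{X r, Y s} \<in> snd (F Q)"
      if "j \<in> {1..m}" "i \<in> {1..n}" "{X j, Y i} \<in> snd (F Q)" "r \<in> {1..j}" "s \<in> {1..i}"
      for j i r s
      using that edge[of i j] edge[of s r] down[of r j s i] by auto
  qed (auto simp: inj_on_def)
  ultimately have "ferrer_diagram Q"
    by (simp add: ferrer_diagram_def wh)
  then show thesis using wh Q_iff by (rule that)
qed

section \<open>Isomorphism of the bipartite graphs under permuted rows and columns\<close>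

lemma F_isomorphic_permuted:
  assumes \<sigma>: "bij_betw \<sigma> {1..width Q} {1..width P}"
    and \<tau>: "bij_betw \<tau> {1..height Q} {1..height P}"
    and iff: "\<And>i j. i \<in> {1..height Q} \<Longrightarrow> j \<in> {1..width Q} \<Longrightarrow>
      box_cell Q i j \<in> Q \<longleftrightarrow> box_cell P (\<tau> i) (\<sigma> j) \<in> P"
  shows "graph_isomorphic (F P) (F Q)"
proof -
  define \<sigma>' where "\<sigma>' = inv_into {1..width Q} \<sigma>"
  define \<tau>' where "\<tau>' = inv_into {1..height Q} \<tau>"
  have s: "\<sigma>' j \<in> {1..width Q}" "\<sigma> (\<sigma>' j) = j" if "j \<in> {1..width P}" for j
    using that bij_betw_inv_into_right[OF \<sigma>] bij_betw_apply[OF bij_betw_inv_into[OF \<sigma>]]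
    by (simp_all add: \<sigma>'_def)
  have t: "\<tau>' i \<in> {1..height Q}" "\<tau> (\<tau>' i) = i" if "i \<in> {1..height P}" for i
    using that bij_betw_inv_into_right[OF \<tau>] bij_betw_apply[OF bij_betw_inv_into[OF \<tau>]]
    by (simp_all add: \<tau>'_def)
  have s': "\<sigma> j \<in> {1..width P}" "\<sigma>' (\<sigma> j) = j" if "j \<in> {1..width Q}" for j
    using that bij_betw_inv_into_left[OF \<sigma>] bij_betw_apply[OF \<sigma>] by (simp_all add: \<sigma>'_def)
  have t': "\<tau> i \<in> {1..height P}" "\<tau>' (\<tau> i) = i" if "i \<in> {1..height Q}" for i
    using that bij_betw_inv_into_left[OF \<tau>] bij_betw_apply[OF \<tau>] by (simp_all add: \<tau>'_def)
  \<comment> \<open>\<open>\<sigma>\<close> and \<open>\<tau>\<close> lead from positions in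
    \<open>Q\<close> to positions in \<open>P\<close>, so the isomorphism from \<open>F P\<close> to
    \<open>F Q\<close> is built from their inverses, and \<open>g\<close> is its inverse.\<close>
  define f where "f = case_vertex (\<lambda>j. X (\<sigma>' j)) (\<lambda>i. Y (\<tau>' i))"
  define g where "g = case_vertex (\<lambda>j. X (\<sigma> j)) (\<lambda>i. Y (\<tau> i))"
  have fg [simp]: "f (X j) = X (\<sigma>' j)" "f (Y i) = Y (\<tau>' i)"
    "g (X j) = X (\<sigma> j)" "g (Y i) = Y (\<tau> i)" for i j
    by (simp_all add: f_def g_def)
  have edge: "{X j, Y i} \<in> snd (F T) \<longleftrightarrow> box_cell T i j \<in> T"
    if "i \<in> {1..height T}" "j \<in> {1..width T}" for i j T
    using that by (auto simp: F_edge_iff)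
  have XY: "{X j, Y i} \<in> snd (F P) \<longleftrightarrow> {X (\<sigma>' j), Y (\<tau>' i)} \<in> snd (F Q)"
    if "j \<in> {1..width P}" "i \<in> {1..height P}" for i j
    using edge[of i P j] edge[of "\<tau>' i" Q "\<sigma>' j"] iff[of "\<tau>' i" "\<sigma>' j"] s[OF that(1)] t[OF that(2)] that
    by simp
  have same: "{X j, X l} \<notin> snd (F T)" "{Y j, Y l} \<notin> snd (F T)" for j l T
    by (simp_all add: F_edge_iff)
  have V: "fst (F T) = X ` {1..width T} \<union> Y ` {1..height T}" for T
    by (simp add: F_def)
  have "bij_betw f (fst (F P)) (fst (F Q))"
  proof (rule bij_betw_byWitness[where f' = g])
    show "\<forall>v\<in>fst (F P). g (f v) = v" "\<forall>v\<in>fst (F Q). f (g v) = v"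
      unfolding V using s t s' t' by auto
    show "f ` fst (F P) \<subseteq> fst (F Q)" "g ` fst (F Q) \<subseteq> fst (F P)"
      unfolding V using s(1) t(1) s'(1) t'(1) by (auto intro!: imageI simp del: atLeastAtMost_iff)
  qed
  moreover have "{v, w} \<in> snd (F P) \<longleftrightarrow> {f v, f w} \<in> snd (F Q)"
    if "v \<in> fst (F P)" "w \<in> fst (F P)" for v w
    \<comment> \<open>Four cases by the classes of \<open>v\<close> and \<open>w\<close>: two
      vertices of one class are adjacent on neither side, and a pair with the \<open>Y\<close>
      vertex first is swapped before \<open>XY\<close> applies.\<close>
    using that unfolding V
    by (elim UnE imageE; simp only: fg same XY insert_commute[of "Y _" "X _"])
  ultimately show ?thesis
    unfolding graph_isomorphic_def by blast
qed

section \<open>Sorting an L-convex polyomino into a Ferrer diagram\<close>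

theorem proposition1p3:
  fixes P :: "point set set"
  assumes "L_convex_polyomino P"
  shows "\<exists>Q. ferrer_diagram Q \<and> graph_isomorphic (F P) (F Q)"
proof -
  let ?m = "width P" and ?n = "height P"
  define R where "R j i \<longleftrightarrow> box_cell P i j \<in> P" for j i
  \<comment> \<open>A column fixes the first coordinate of a corner and a row the second, so this is
    the corner property in terms of box positions.\<close>
  have "R j k \<or> R l i" if "R j i" "R l k" for j i l k
    using that L_convex_corner[OF assms] by (simp add: R_def box_cell_def)
  then obtain \<sigma> \<tau> where \<sigma>: "bij_betw \<sigma> {1..?m} {1..?m}" and \<tau>: "bij_betw \<tau> {1..?n} {1..?n}"
    and down: "\<And>r j s i. 1 \<le> r \<Longrightarrow> r \<le> j \<Longrightarrow> j \<le> ?m \<Longrightarrow> 1 \<le> s \<Longrightarrow> s \<le> i \<Longrightarrow> i \<le> ?n \<Longrightarrow>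
      R (\<sigma> j) (\<tau> i) \<Longrightarrow> R (\<sigma> r) (\<tau> s)"
    using chain_graph_sorting[of ?m ?n R] by blast
  have m: "1 \<le> ?m" and n: "1 \<le> ?n"
    using L_convex_width_pos[OF assms] L_convex_height_pos[OF assms] by simp_all
  \<comment> \<open>The row sorted last still contains a cell, in some column
    \<open>\<sigma> r\<close>; \<open>down\<close> moves it to column \<open>\<sigma> 1\<close>. The
    column sorted last is treated in the same way below.\<close>
  have "\<tau> ?n \<in> {1..?n}"
    using n by (intro bij_betw_apply[OF \<tau>]) simp
  then obtain j where "j \<in> {1..?m}" "R j (\<tau> ?n)"
    using L_convex_row[OF assms] unfolding R_def by blast
  moreover from this obtain r where "r \<in> {1..?m}" "\<sigma> r = j"
    using \<sigma> by (metis bij_betw_imp_surj_on imageE)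
  ultimately have R1n: "R (\<sigma> 1) (\<tau> ?n)"
    using down[of 1 r ?n ?n] n by auto
  have "\<sigma> ?m \<in> {1..?m}"
    using m by (intro bij_betw_apply[OF \<sigma>]) simp
  then obtain i where "i \<in> {1..?n}" "R (\<sigma> ?m) i"
    using L_convex_column[OF assms] unfolding R_def by blast
  moreover from this obtain s where "s \<in> {1..?n}" "\<tau> s = i"
    using \<tau> by (metis bij_betw_imp_surj_on imageE)
  ultimately have Rm1: "R (\<sigma> ?m) (\<tau> 1)"
    using down[of ?m ?m 1 s] m by auto
  \<comment> \<open>Position \<open>(j, i)\<close> of the new diagram stands for column
    \<open>\<sigma> j\<close> and row \<open>\<tau> i\<close> of \<open>P\<close>. As the boxes have
    equal size, \<open>\<sigma>\<close> and \<open>\<tau>\<close> also serve as bijections between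
    the index ranges of \<open>Q\<close> and \<open>P\<close>.\<close>
  obtain Q where Q: "ferrer_diagram Q" "width Q = ?m" "height Q = ?n"
    "\<And>i j. i \<in> {1..?n} \<Longrightarrow> j \<in> {1..?m} \<Longrightarrow> box_cell Q i j \<in> Q \<longleftrightarrow> R (\<sigma> j) (\<tau> i)"
    by (rule ferrer_diagram_of_relation[of ?m ?n "\<lambda>j i. R (\<sigma> j) (\<tau> i)"])
      (use m n down R1n Rm1 in blast)+
  have "graph_isomorphic (F P) (F Q)"
    by (rule F_isomorphic_permuted[of \<sigma> _ _ \<tau>]) (use \<sigma> \<tau> Q in \<open>simp_all add: R_def\<close>)
  with Q(1) show ?thesis by blast
qed

end
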